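(* Every connected split graph $G$ (finite, simple, undirected, with $n \ge 2$ vertices) is well-burnable, i.e. $b(G) \leq \lceil \sqrt{n}\, \rceil$.
   Context: A split graph is a graph whose vertex set can be partitioned into a clique (a set of mutually adjacent vertices) and an independent set (a set of mutually non-adjacent vertices). Graph burning: initially all vertices of a finite simple undirected graph $G$ are unburned. The process runs in rounds $t = 1, 2, 3, \dots$. In round $t$, a vertex $x_t$ that is not burned at the end of round $t-1$ is chosen as a new source of fire and becomes burned; simultaneously, every vertex adjacent to a vertex that was burned at the end of round $t-1$ becomes burned. Burned vertices remain burned. The process ends at the first round after which all vertices of $G$ are burned. The burning number $b(G)$ is the minimum, over all choices of sources, of the number of rounds needed to burn all vertices of $G$. A connected graph $G$ on $n$ vertices is called well-burnable if $b(G) \leq \lceil \sqrt{n}\, \rceil$. *)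

theory Defs
  imports Complex_Main "Graph_Theory.Graph_Theory"
begin

definition clique_in :: "('a, 'b) pre_digraph \<Rightarrow> 'a set \<Rightarrow> bool" where
  "clique_in G K \<longleftrightarrow> K \<subseteq> verts G \<and> (\<forall>u\<in>K. \<forall>v\<in>K. u \<noteq> v \<longrightarrow> u \<rightarrow>\<^bsub>G\<^esub> v)"

definition independent_in :: "('a, 'b) pre_digraph \<Rightarrow> 'a set \<Rightarrow> bool" where
  "independent_in G I \<longleftrightarrow> I \<subseteq> verts G \<and> (\<forall>u\<in>I. \<forall>v\<in>I. \<not> u \<rightarrow>\<^bsub>G\<^esub> v)"

text \<open>Either part of the partition may be empty.\<close>

definition split_graph :: "('a, 'b) pre_digraph \<Rightarrow> bool" where
  "split_graph G \<longleftrightarrow> graph G \<and>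
     (\<exists>K I. K \<union> I = verts G \<and> K \<inter> I = {} \<and> clique_in G K \<and> independent_in G I)"

text \<open>The set of vertices burned at the end of round \<open>t\<close>, where \<open>x t\<close> is the source chosen
  in round \<open>t \<ge> 1\<close>; the value \<open>x 0\<close> is never used.\<close>

primrec burned :: "('a, 'b) pre_digraph \<Rightarrow> (nat \<Rightarrow> 'a) \<Rightarrow> nat \<Rightarrow> 'a set" where
  "burned G x 0 = {}"
| "burned G x (Suc t) =
     burned G x t \<union> {x (Suc t)} \<union> {v \<in> verts G. \<exists>u \<in> burned G x t. u \<rightarrow>\<^bsub>G\<^esub> v}"

definition valid_sources :: "('a, 'b) pre_digraph \<Rightarrow> (nat \<Rightarrow> 'a) \<Rightarrow> nat \<Rightarrow> bool" where
  "valid_sources G x k \<longleftrightarrow> (\<forall>t\<in>{1..k}. x t \<in> verts G - burned G x (t - 1))"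

text \<open>As the source of each round up to \<open>k\<close> is unburned before that round, \<open>k\<close> is
  necessarily the first round after which all vertices are burned.\<close>

definition burns_in :: "('a, 'b) pre_digraph \<Rightarrow> (nat \<Rightarrow> 'a) \<Rightarrow> nat \<Rightarrow> bool" where
  "burns_in G x k \<longleftrightarrow> valid_sources G x k \<and> burned G x k = verts G"

definition burning_number :: "('a, 'b) pre_digraph \<Rightarrow> nat" where
  "burning_number G = (LEAST k. \<exists>x. burns_in G x k)"

text \<open>The minimum is attained: a finite graph can always be burned.\<close>

lemma burned_cong:
  "(\<And>t. t \<in> {1..k} \<Longrightarrow> x t = y t) \<Longrightarrow> burned G x k = burned G y k"
  by (induction k) auto

lemma valid_sources_SucD: "valid_sources G x (Suc k) \<Longrightarrow> valid_sources G x k"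
  by (auto simp: valid_sources_def)

lemma burned_subset: "valid_sources G x k \<Longrightarrow> burned G x k \<subseteq> verts G"
proof (induction k)
  case (Suc k)
  have "x (Suc k) \<in> verts G"
    using Suc.prems by (auto simp: valid_sources_def)
  with Suc.IH[OF valid_sources_SucD[OF Suc.prems]] show ?case by auto
qed simp

lemma valid_sources_card:
  assumes "finite (verts G)"
  shows "valid_sources G x k \<Longrightarrow> k \<le> card (burned G x k)"
proof (induction k)
  case (Suc k)
  have fin: "finite (burned G x k)" "finite (burned G x (Suc k))"
    using burned_subset[OF valid_sources_SucD[OF Suc.prems]] burned_subset[OF Suc.prems] assms
    by (auto intro: finite_subset simp del: burned.simps)
  have "x (Suc k) \<notin> burned G x k"
    using bspec[OF Suc.prems[unfolded valid_sources_def], of "Suc k"] by simp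
  then have "card (insert (x (Suc k)) (burned G x k)) = Suc (card (burned G x k))"
    using fin by simp
  moreover have "card (insert (x (Suc k)) (burned G x k)) \<le> card (burned G x (Suc k))"
    by (rule card_mono[OF fin(2)]) auto
  ultimately show ?case
    using Suc.IH[OF valid_sources_SucD[OF Suc.prems]] by linarith
qed simp

lemma burns_in_exists:
  assumes "finite (verts G)"
  shows "\<exists>k x. burns_in G x k"
proof -
  let ?P = "\<lambda>k. \<exists>x. valid_sources G x k"
  have bound: "k \<le> card (verts G)" if "?P k" for k
    using that valid_sources_card[OF assms] burned_subset card_mono[OF assms]
    by (meson le_trans)
  have "?P 0" by (simp add: valid_sources_def)
  then obtain k where k: "?P k" and max: "\<And>j. ?P j \<Longrightarrow> j \<le> k"
    using GreatestI_nat[of ?P 0] Greatest_le_nat[of ?P] bound by blast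
  from k obtain x where x: "valid_sources G x k" ..
  have "burned G x k = verts G"
  proof (rule ccontr)
    assume "burned G x k \<noteq> verts G"
    then obtain v where v: "v \<in> verts G - burned G x k"
      using burned_subset[OF x] by auto
    let ?y = "x(Suc k := v)"
    have eq: "burned G ?y j = burned G x j" if "j \<le> k" for j
      by (rule burned_cong) (use that in auto)
    have "valid_sources G ?y (Suc k)"
      unfolding valid_sources_def
    proof
      fix t assume t: "t \<in> {1..Suc k}"
      show "?y t \<in> verts G - burned G ?y (t - 1)"
        using t v x eq[of "t - 1"] by (cases "t = Suc k") (auto simp: valid_sources_def)
    qed
    then show False using max[of "Suc k"] by auto
  qed
  with x show ?thesis by (auto simp: burns_in_def)
qed

definition well_burnable :: "('a, 'b) pre_digraph \<Rightarrow> bool" where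
  "well_burnable G \<longleftrightarrow> int (burning_number G) \<le> \<lceil>sqrt (real (card (verts G)))\<rceil>"

end

theory Submission
  imports Defs
begin

text \<open>A vertex of the clique reaches every vertex within two steps, so three rounds always
  suffice; this settles \<open>n \<ge> 5\<close>. For \<open>n \<le> 4\<close> some clique vertex is adjacent to all but at most
  one of the other vertices, and choosing that exception as second source finishes in two rounds.\<close>

lemma burning_number_le: "burns_in G x k \<Longrightarrow> burning_number G \<le> k"
  unfolding burning_number_def by (rule Least_le) blast

lemma valid_sources_Suc_iff:
  "valid_sources G x (Suc k) \<longleftrightarrow> valid_sources G x k \<and> x (Suc k) \<in> verts G - burned G x k"
proof -
  have "{1..Suc k} = insert (Suc k) {1..k}" by auto
  then show ?thesis unfolding valid_sources_def by auto
qed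

lemma valid_sources_cong:
  "(\<And>t. t \<in> {1..k} \<Longrightarrow> x t = y t) \<Longrightarrow> valid_sources G x k = valid_sources G y k"
proof (induction k)
  case 0
  show ?case by (simp add: valid_sources_def)
next
  case (Suc k)
  have "burned G x k = burned G y k"
    by (rule burned_cong) (simp add: Suc.prems)
  moreover have "valid_sources G x k = valid_sources G y k"
    by (rule Suc.IH) (simp add: Suc.prems)
  moreover have "x (Suc k) = y (Suc k)"
    by (simp add: Suc.prems)
  ultimately show ?case by (simp only: valid_sources_Suc_iff)
qed

text \<open>Lets the last source be picked after seeing what the first \<open>k\<close> rounds burn:
  redefining \<open>x\<close> at \<open>Suc k\<close> changes neither \<open>burned\<close> nor
  \<open>valid_sources\<close> up to round \<open>k\<close>.\<close>

lemma burning_number_le_extend: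
  assumes "valid_sources G x k" "w \<in> verts G" "w \<notin> burned G x k"
    and "insert w (burned G x k \<union> {v \<in> verts G. \<exists>u \<in> burned G x k. u \<rightarrow>\<^bsub>G\<^esub> v}) = verts G"
  shows "burning_number G \<le> Suc k"
proof -
  let ?y = "x(Suc k := w)"
  have eq: "burned G ?y k = burned G x k"
    by (rule burned_cong) auto
  have "valid_sources G ?y k = valid_sources G x k"
    by (rule valid_sources_cong) auto
  then have "burns_in G ?y (Suc k)"
    using assms eq unfolding burns_in_def valid_sources_Suc_iff by auto
  then show ?thesis by (rule burning_number_le)
qed

text \<open>Starting at \<open>v\<close>, the second round spreads to all neighbours of
  \<open>v\<close>, and its source covers the only vertex that may be left. The one-vertex graph is
  separate because the process then ends after round 1.\<close>

lemma burning_number_le_2: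
  assumes v: "v \<in> verts G" and "finite (verts G)"
    and card: "card (verts G - insert v {u. v \<rightarrow>\<^bsub>G\<^esub> u}) \<le> 1"
  shows "burning_number G \<le> 2"
proof (cases "verts G = {v}")
  case True
  then have "burns_in G (\<lambda>_. v) 1"
    by (auto simp: burns_in_def valid_sources_def)
  then show ?thesis using burning_number_le by fastforce
next
  case False
  let ?R = "verts G - insert v {u. v \<rightarrow>\<^bsub>G\<^esub> u}"
  \<comment> \<open>The second source must be unburned, that is, different from \<open>v\<close>; if
    nothing is left over, any other vertex will do.\<close>
  have "\<exists>w \<in> verts G - {v}. ?R \<subseteq> {w}"
  proof (cases "?R = {}")
    case True
    then show ?thesis using False v by blast
  next
    case False
    then have "card ?R = 1"
      using card assms(2) by (metis card_0_eq finite_Diff le_SucE One_nat_def le_zero_eq)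
    then show ?thesis by (auto simp: card_1_singleton_iff)
  qed
  then obtain w where w: "w \<in> verts G" "w \<noteq> v" "?R \<subseteq> {w}" by blast
  have "burning_number G \<le> Suc 1"
    by (rule burning_number_le_extend[where x = "\<lambda>_. v" and w = w])
       (use v w in \<open>auto simp: valid_sources_def\<close>)
  then show ?thesis by simp
qed

text \<open>The fire lit at \<open>v\<close> alone covers the ball of radius 2 by round 3. The later
  sources only have to be legal, and the case splits deal with a process that ends earlier.\<close>

lemma burning_number_le_3:
  assumes v: "v \<in> verts G"
    and dist: "\<And>w. w \<in> verts G \<Longrightarrow> w = v \<or> v \<rightarrow>\<^bsub>G\<^esub> w \<or> (\<exists>u \<in> verts G. v \<rightarrow>\<^bsub>G\<^esub> u \<and> u \<rightarrow>\<^bsub>G\<^esub> w)"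
  shows "burning_number G \<le> 3"
proof (cases "verts G = {v}")
  case True
  then have "burns_in G (\<lambda>_. v) 1"
    by (auto simp: burns_in_def valid_sources_def)
  then show ?thesis using burning_number_le by fastforce
next
  case False
  then obtain s where s: "s \<in> verts G" "s \<noteq> v" using v by blast
  define x where "x t = (if t = 1 then v else s)" for t :: nat
  have B: "burned G x (Suc 0) = {v}" "burned G x (Suc (Suc 0)) = {v, s} \<union> {u \<in> verts G. v \<rightarrow>\<^bsub>G\<^esub> u}"
    by (auto simp: x_def)
  have valid: "valid_sources G x (Suc (Suc 0))"
    using v s B(1) unfolding valid_sources_Suc_iff
    by (auto simp: valid_sources_def x_def)
  show ?thesis
  \<comment> \<open>If two rounds already burn everything, no legal third source exists; otherwise
    any unburned vertex serves.\<close>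
  proof (cases "burned G x (Suc (Suc 0)) = verts G")
    case True
    with valid have "burns_in G x (Suc (Suc 0))" by (simp only: burns_in_def)
    then show ?thesis using burning_number_le by fastforce
  next
    case False
    then obtain w where w: "w \<in> verts G" "w \<notin> burned G x (Suc (Suc 0))"
      using burned_subset[OF valid] by blast
    have "burning_number G \<le> Suc (Suc (Suc 0))"
    proof (rule burning_number_le_extend[OF valid w])
      show "insert w (burned G x (Suc (Suc 0)) \<union>
        {a \<in> verts G. \<exists>u \<in> burned G x (Suc (Suc 0)). u \<rightarrow>\<^bsub>G\<^esub> a}) = verts G" (is "?L = _")
      proof
        show "?L \<subseteq> verts G" using burned_subset[OF valid] w(1) by blast
        show "verts G \<subseteq> ?L" unfolding B(2) using dist by blast
      qed
    qed
    then show ?thesis by simp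
  qed
qed

text \<open>Symmetry of the arcs turns connectedness into directed reachability, and the first arc
  of a walk from \<open>u\<close> to \<open>w\<close> gives the neighbour.\<close>

lemma (in sym_digraph) connected_has_neighbour:
  assumes "connected G" "u \<in> verts G" "w \<in> verts G" "w \<noteq> u"
  shows "\<exists>v \<in> verts G. u \<rightarrow>\<^bsub>G\<^esub> v"
proof -
  have "u \<rightarrow>\<^sup>*\<^bsub>G\<^esub> w"
    using symmetric_connected_imp_strongly_connected[OF sym_arcs] assms by blast
  then show ?thesis
    using \<open>w \<noteq> u\<close> by (cases rule: converse_reachable_cases) (auto dest: adj_in_verts)
qed

theorem mainTheorem3:
  fixes G :: "('a, 'b) pre_digraph"
  assumes "split_graph G"
    and "Digraph_Component.connected G"
    and "card (verts G) \<ge> 2"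
  shows "well_burnable G"
proof -
  from assms(1) obtain K I where "graph G" and KI: "K \<union> I = verts G" "K \<inter> I = {}"
    and K: "clique_in G K" and I: "independent_in G I"
    unfolding split_graph_def by blast
  interpret graph G by fact
  have fin: "finite K" "finite I"
    using KI(1) finite_verts by (metis finite_Un)+
  have cardG: "card (verts G) = card K + card I"
    using KI fin by (metis card_Un_disjoint)
  have adjK: "u \<rightarrow>\<^bsub>G\<^esub> v" if "u \<in> K" "v \<in> K" "u \<noteq> v" for u v
    using K that by (auto simp: clique_in_def)
  have sym: "v \<rightarrow>\<^bsub>G\<^esub> u" if "u \<rightarrow>\<^bsub>G\<^esub> v" for u v
    using that by (rule graph_symmetric)
  \<comment> \<open>Connectedness supplies a neighbour, and independence of \<open>I\<close> forces
    it into \<open>K\<close>.\<close>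
  have nbr: "\<exists>v \<in> K. v \<rightarrow>\<^bsub>G\<^esub> u" if "u \<in> I" for u
  proof -
    have "u \<in> verts G" using that KI by blast
    moreover have "verts G \<noteq> {u}" using assms(3) by auto
    then obtain w where "w \<in> verts G" "w \<noteq> u" using \<open>u \<in> verts G\<close> by blast
    ultimately obtain v where "v \<in> verts G" "u \<rightarrow>\<^bsub>G\<^esub> v"
      using connected_has_neighbour[OF assms(2)] by blast
    moreover have "v \<notin> I" using I that \<open>u \<rightarrow>\<^bsub>G\<^esub> v\<close> by (auto simp: independent_in_def)
    ultimately show ?thesis using KI sym by blast
  qed
  have "verts G \<noteq> {}" using assms(3) by auto
  then have "K \<noteq> {}" using nbr KI(1) by blast
  then obtain c where c: "c \<in> K" by blast
  show ?thesis
  proof (cases "card (verts G) \<ge> 5")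
    case True
    have "burning_number G \<le> 3"
    proof (rule burning_number_le_3[of c])
      show "c \<in> verts G" using c KI by blast
      show "w = c \<or> c \<rightarrow>\<^bsub>G\<^esub> w \<or> (\<exists>u \<in> verts G. c \<rightarrow>\<^bsub>G\<^esub> u \<and> u \<rightarrow>\<^bsub>G\<^esub> w)" if "w \<in> verts G" for w
      proof (cases "w \<in> K")
        case True
        then show ?thesis using adjK[OF c, of w] by auto
      next
        case False
        then have "w \<in> I" using that KI(1) by auto
        then obtain u where "u \<in> K" "u \<rightarrow>\<^bsub>G\<^esub> w" using nbr by auto
        then show ?thesis using adjK[OF c, of u] KI(1) by auto
      qed
    qed
    \<comment> \<open>The threshold 5 is the least order above 4, hence the least at which the
      ceiling reaches 3.\<close>
    moreover have "2 < sqrt (real (card (verts G)))"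
      using True by (intro real_less_rsqrt) simp
    then have "3 \<le> \<lceil>sqrt (real (card (verts G)))\<rceil>"
      by (simp add: le_ceiling_iff)
    ultimately show ?thesis unfolding well_burnable_def by linarith
  next
    case False
    have "\<exists>v \<in> K. card (verts G - insert v {u. v \<rightarrow>\<^bsub>G\<^esub> u}) \<le> 1"
    proof (cases "I = {}")
      case True
      then have "verts G - insert c {u. c \<rightarrow>\<^bsub>G\<^esub> u} = {}" 
        using KI(1) adjK[OF c] by auto
      then show ?thesis using c by (metis card.empty zero_le)
    next
      case False
      then obtain w v where w: "w \<in> I" and v: "v \<in> K" "v \<rightarrow>\<^bsub>G\<^esub> w" using nbr by blast
      let ?R = "verts G - insert v {u. v \<rightarrow>\<^bsub>G\<^esub> u}"
      \<comment> \<open>Since \<open>v\<close> is adjacent to the rest of the clique and to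
        \<open>w\<close>, it can miss only the other independent vertices.\<close>
      have R: "?R \<subseteq> I - {w}" using KI(1) v(2) adjK[OF v(1)] by auto
      show ?thesis
      proof (cases "card I \<le> 2")
        case True
        have "card ?R \<le> card (I - {w})" using R fin by (intro card_mono) auto
        also have "\<dots> \<le> 1" using True w fin by simp
        finally show ?thesis using v by blast
      next
        case False
        \<comment> \<open>At most 4 vertices with at least 3 of them in \<open>I\<close> leave one
          for \<open>K\<close>, so the graph is a star with centre \<open>v\<close>.\<close>
        with cardG \<open>\<not> card (verts G) \<ge> 5\<close> have "card K \<le> 1" by linarith
        then have "K = {v}" using v(1) fin by (auto simp: card_le_Suc0_iff_eq)
        then have "?R = {}" using KI(1) nbr by auto
        then show ?thesis using v by (metis card.empty zero_le)
      qed
    qed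
    then obtain v where v: "v \<in> K" "card (verts G - insert v {u. v \<rightarrow>\<^bsub>G\<^esub> u}) \<le> 1" ..
    moreover have "v \<in> verts G" using v(1) KI(1) by auto
    ultimately have "burning_number G \<le> 2"
      by (intro burning_number_le_2[of v]) simp_all
    moreover have "1 < sqrt (real (card (verts G)))"
      using assms(3) by (intro real_less_rsqrt) simp
    then have "2 \<le> \<lceil>sqrt (real (card (verts G)))\<rceil>"
      by (simp add: le_ceiling_iff)
    ultimately show ?thesis unfolding well_burnable_def by linarith
  qed
qed

end
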